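(* Let $\boldsymbol{\mathcal{A}}=(\mathcal{A}_0,\dots,\mathcal{A}_n)$ be a family of nonempty finite subsets of a lattice $M$ of rank $n$, let $\rho_i\colon\Delta_i\to\mathbb{R}$, $i=0,\dots,n$, be convex piecewise affine functions defined on $\mathcal{A}_i$, with $\Delta_i=\operatorname{conv}(\mathcal{A}_i)$, whose inf-convolution $\rho$ induces a tight mixed subdivision $S(\rho)$ of $\Delta=\sum_i\Delta_i$, and let $\delta\in M_{\mathbb{R}}$ be generic with respect to $S(\rho)$. Let $\phi_i\colon\Delta_i\to\mathbb{R}$, $i=0,\dots,n$, be another family of convex piecewise affine functions with inf-convolution $\phi$, and suppose that $S(\phi)\preceq S(\rho)$. Let $D$ be an $n$-cell of $S(\phi)$, with components $D_0,\dots,D_n$ (with respect to the family $\phi_0,\dots,\phi_n$). Then (1) $\rho_i|_{D_i}$ is a convex piecewise affine function on $D_i$ defined on $\mathcal{A}_i\cap D_i$ for each $i$; (2) $\boxplus_{i=0}^n\rho_i|_{D_i}=\rho|_D$; (3) the mixed subdivision $S(\boxplus_{i=0}^n\rho_i|_{D_i})$ of $D$ is tight; (4) the vector $\delta$ is generic with respect to $S(\boxplus_{i=0}^n\rho_i|_{D_i})$.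
   Context: $M\simeq\mathbb{Z}^n$, $N=\operatorname{Hom}(M,\mathbb{Z})$, $M_{\mathbb{R}}=M\otimes\mathbb{R}$, $N_{\mathbb{R}}=N\otimes\mathbb{R}$. For a convex piecewise affine function $\rho\colon\Delta\to\mathbb{R}$ on a polytope and $v\in N_{\mathbb{R}}$ put $\Gamma(\rho,v)=\{x\in\Delta\mid \rho(x)+\langle v,x\rangle=\min_{y\in\Delta}(\rho(y)+\langle v,y\rangle)\}$. The subdivision $S(\rho)$ of $\Delta$ is the collection of all the sets $\Gamma(\rho,v)$, called cells; an $n$-cell is a cell of dimension $n$. The inf-convolution of $\rho_i\colon\Delta_i\to\mathbb{R}$, $i=0,\dots,n$, is $\rho=\boxplus_i\rho_i\colon\Delta=\sum_i\Delta_i\to\mathbb{R}$, $\rho(x)=\inf\{\sum_i\rho_i(x_i)\mid x_i\in\Delta_i,\sum_ix_i=x\}$, and $S(\rho)$ is called a mixed subdivision of $\Delta$. The $i$-th component of $C\in S(\rho)$ is the set $C_i$ of $x_i\in\Delta_i$ for which there are $x_j\in\Delta_j$, $j\ne i$, with $\sum_jx_j\in C$ and $\rho(\sum_jx_j)=\sum_j\rho_j(x_j)$; if $C=\Gamma(\rho,v)$ then $C_i=\Gamma(\rho_i,v)$. $S(\rho)$ is tight if $\sum_{i}\dim(C_i)=n$ for every $n$-cell $C$. One writes $S(\phi)\preceq S(\rho)$ if for every $C\in S(\rho)$ there is $D\in S(\phi)$ with $C\subset D$ and $C_i\subset D_i$ for all $i$. A function $\rho_i\colon\Delta_i\to\mathbb{R}$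 on a polytope is a convex piecewise affine function defined on a finite set $\mathcal{A}_i\subset M$ if $\Delta_i=\operatorname{conv}(\mathcal{A}_i)$ and there is $\boldsymbol{\nu}_i\in\mathbb{R}^{\mathcal{A}_i}$ such that $\rho_i(x)=\min\{z\mid(x,z)\in\operatorname{conv}\{(a,\nu_{i,a})\}_{a\in\mathcal{A}_i}\}$ for all $x\in\Delta_i$. A vector $\delta\in M_{\mathbb{R}}$ is generic with respect to a mixed subdivision $S(\rho)$ if $(|S(\rho)^{n-1}|+\delta)\cap M=\emptyset$, where $|S(\rho)^{n-1}|$ is the $(n-1)$-skeleton of $S(\rho)$, i.e. the union of its cells of dimension at most $n-1$. *)

theory Defs
  imports "HOL-Analysis.Analysis" "HOL-Library.Set_Algebras"
begin

text \<open>
  A lattice \<open>M\<close> of rank \<open>n\<close> is the integer span of \<open>n\<close> linearly independent vectors of a Euclidean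
  space, and \<open>M\<^sub>\<real>\<close> is \<open>span M\<close>.  The ambient space may be larger than \<open>span M\<close>, so that rank \<open>0\<close>
  is included.  Every linear form on \<open>span M\<close> is of the form \<open>x \<mapsto> v \<bullet> x\<close>, so \<open>N\<^sub>\<real>\<close> is represented by
  vectors \<open>v\<close> of the ambient space; vectors that differ by an element orthogonal to \<open>span M\<close> give
  the same linear form.
\<close>

definition lattice_of_rank :: "nat \<Rightarrow> 'a::euclidean_space set \<Rightarrow> bool" where
  "lattice_of_rank n M \<longleftrightarrow>
     (\<exists>B. independent B \<and> card B = n \<and> M = range (\<lambda>c. \<Sum>b\<in>B. real_of_int (c b) *\<^sub>R b))"

text \<open>
  A function with domain \<open>P\<close> is a total function whose values outside \<open>P\<close> are never used; its
  restriction to a subset is expressed by replacing the domain.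
\<close>

definition convex_piecewise_affine_on :: "'a::euclidean_space set \<Rightarrow> ('a \<Rightarrow> real) \<Rightarrow> bool" where
  "convex_piecewise_affine_on P f \<longleftrightarrow>
     polytope P \<and> convex_on P f \<and>
     (\<exists>\<Q>. finite \<Q> \<and> \<Union>\<Q> = P \<and>
        (\<forall>Q\<in>\<Q>. polytope Q \<and> (\<exists>v c. \<forall>x\<in>Q. f x = v \<bullet> x + c)))"

definition cpa_defined_on :: "'a::euclidean_space set \<Rightarrow> 'a set \<Rightarrow> ('a \<Rightarrow> real) \<Rightarrow> bool" where
  "cpa_defined_on A P f \<longleftrightarrow>
     finite A \<and> P = convex hull A \<and>
     (\<exists>\<nu> :: 'a \<Rightarrow> real. \<forall>x\<in>P.
        (x, f x) \<in> convex hull ((\<lambda>a. (a, \<nu> a)) ` A) \<and>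
        (\<forall>z. (x, z) \<in> convex hull ((\<lambda>a. (a, \<nu> a)) ` A) \<longrightarrow> f x \<le> z))"

definition Gam :: "'a::euclidean_space set \<Rightarrow> ('a \<Rightarrow> real) \<Rightarrow> 'a \<Rightarrow> 'a set" where
  "Gam P f v = {x \<in> P. \<forall>y\<in>P. f x + v \<bullet> x \<le> f y + v \<bullet> y}"

definition subdivision :: "'a::euclidean_space set \<Rightarrow> ('a \<Rightarrow> real) \<Rightarrow> 'a set set" where
  "subdivision P f = range (Gam P f)"

text \<open>
  A family \<open>\<rho>\<^sub>0, \<dots>, \<rho>\<^sub>n\<close> with domains \<open>\<Delta>\<^sub>0, \<dots>, \<Delta>\<^sub>n\<close> is a pair of functions on \<open>nat\<close> of which only the
  values at indices \<open>i \<le> n\<close> matter.  The sum \<open>\<Sum>i\<le>n. \<Delta> i\<close> is the Minkowski sum.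
\<close>

definition inf_conv ::
  "nat \<Rightarrow> (nat \<Rightarrow> 'a::euclidean_space set) \<Rightarrow> (nat \<Rightarrow> 'a \<Rightarrow> real) \<Rightarrow> 'a \<Rightarrow> real" where
  "inf_conv n \<Delta> \<rho> x =
     Inf {\<Sum>i\<le>n. \<rho> i (y i) | y. (\<forall>i\<le>n. y i \<in> \<Delta> i) \<and> (\<Sum>i\<le>n. y i) = x}"

definition mixed_subdivision ::
  "nat \<Rightarrow> (nat \<Rightarrow> 'a::euclidean_space set) \<Rightarrow> (nat \<Rightarrow> 'a \<Rightarrow> real) \<Rightarrow> 'a set set" where
  "mixed_subdivision n \<Delta> \<rho> = subdivision (\<Sum>i\<le>n. \<Delta> i) (inf_conv n \<Delta> \<rho>)"

definition component ::
  "nat \<Rightarrow> (nat \<Rightarrow> 'a::euclidean_space set) \<Rightarrow> (nat \<Rightarrow> 'a \<Rightarrow> real) \<Rightarrow> 'a set \<Rightarrow> nat \<Rightarrow> 'a set" where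
  "component n \<Delta> \<rho> C i =
     {y i | y. (\<forall>j\<le>n. y j \<in> \<Delta> j) \<and> (\<Sum>j\<le>n. y j) \<in> C \<and>
               inf_conv n \<Delta> \<rho> (\<Sum>j\<le>n. y j) = (\<Sum>j\<le>n. \<rho> j (y j))}"

text \<open>
  In what follows \<open>n\<close> is also the rank of the lattice, so an \<open>n\<close>-cell is a cell of affine
  dimension \<open>n\<close>.
\<close>

definition tight_mixed_subdivision ::
  "nat \<Rightarrow> (nat \<Rightarrow> 'a::euclidean_space set) \<Rightarrow> (nat \<Rightarrow> 'a \<Rightarrow> real) \<Rightarrow> bool" where
  "tight_mixed_subdivision n \<Delta> \<rho> \<longleftrightarrow>
     (\<forall>C\<in>mixed_subdivision n \<Delta> \<rho>. aff_dim C = int n \<longrightarrow>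
        (\<Sum>i\<le>n. aff_dim (component n \<Delta> \<rho> C i)) = int n)"

text \<open>\<open>mixed_preceq n \<Delta> \<phi> \<rho>\<close> is \<open>S(\<phi>) \<preceq> S(\<rho>)\<close> for two families on the same domains.\<close>

definition mixed_preceq ::
  "nat \<Rightarrow> (nat \<Rightarrow> 'a::euclidean_space set) \<Rightarrow> (nat \<Rightarrow> 'a \<Rightarrow> real) \<Rightarrow> (nat \<Rightarrow> 'a \<Rightarrow> real) \<Rightarrow> bool" where
  "mixed_preceq n \<Delta> \<phi> \<rho> \<longleftrightarrow>
     (\<forall>C\<in>mixed_subdivision n \<Delta> \<rho>. \<exists>D\<in>mixed_subdivision n \<Delta> \<phi>.
        C \<subseteq> D \<and> (\<forall>i\<le>n. component n \<Delta> \<rho> C i \<subseteq> component n \<Delta> \<phi> D i))"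

definition codim1_skeleton ::
  "nat \<Rightarrow> (nat \<Rightarrow> 'a::euclidean_space set) \<Rightarrow> (nat \<Rightarrow> 'a \<Rightarrow> real) \<Rightarrow> 'a set" where
  "codim1_skeleton n \<Delta> \<rho> = \<Union>{C \<in> mixed_subdivision n \<Delta> \<rho>. aff_dim C \<le> int n - 1}"

definition generic_wrt ::
  "'a::euclidean_space set \<Rightarrow> nat \<Rightarrow> (nat \<Rightarrow> 'a set) \<Rightarrow> (nat \<Rightarrow> 'a \<Rightarrow> real) \<Rightarrow> 'a \<Rightarrow> bool" where
  "generic_wrt M n \<Delta> \<rho> \<delta> \<longleftrightarrow> (\<lambda>x. x + \<delta>) ` codim1_skeleton n \<Delta> \<rho> \<inter> M = {}"

end

theory Submission
  imports Defs
begin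

text \<open>
  Both kinds of input functions, and also their inf-convolutions, are lower boundaries of convex
  hulls of finitely many points of \<open>E \<times> \<real>\<close>, where \<open>E\<close> is the ambient space.  Three facts follow
  from this finiteness: every point of the domain lies in a cell
  (\<open>lower_boundary_subgradient\<close>), the graph over a cell is spanned by the generators
  above that cell (\<open>lower_boundary_minimal_generators\<close>), and a relative boundary point of a cell
  lies in a cell of smaller dimension (\<open>Gam_proper_face\<close>).  For a family, \<open>Gam_sum_iff\<close> says that a
  sum \<open>\<Sum>y\<^sub>i\<close> lies in the cell of direction \<open>t\<close> and is an optimal decomposition exactly if every \<open>y\<^sub>i\<close>
  lies in the cell of direction \<open>t\<close> of its own function.  So components of cells are cells with
  the same direction.

  Let \<open>D\<close> be the cell of \<open>S(\<phi>)\<close> of direction \<open>v\<close>, with components \<open>D\<^sub>i\<close>.  For (1), take \<open>x \<in> D\<^sub>i\<close>.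
  It lies in some cell of \<open>\<rho>\<^sub>i\<close>, which is contained in a cell of \<open>\<phi>\<^sub>i\<close>, say of direction \<open>t'\<close>.  On
  that larger cell \<open>\<phi>\<^sub>i\<close> is affine, so \<open>D\<^sub>i\<close> cuts it in the face where \<open>v - t'\<close> is minimal.  Therefore
  the generators of the \<open>\<rho>\<^sub>i\<close>-cell that are needed to represent \<open>x\<close> all lie in \<open>D\<^sub>i\<close>.  For (2), an
  optimal \<open>\<rho>\<close>-decomposition of \<open>x \<in> D\<close> has its terms in the components of a cell of \<open>S(\<rho>)\<close>, hence of a
  cell of \<open>S(\<phi>)\<close>.  So it is also optimal for \<open>\<phi>\<close>, which puts the terms in the \<open>D\<^sub>i\<close>: nothing is lost
  by restricting the decompositions to \<open>D\<close>.

  For (3) and (4) the dimension enters.  If two cells of one subdivision share a point, and that point is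
  relatively interior to a full-dimensional subset of one of them, then their directions
  agree on \<open>span M\<close> and the two cells are equal (\<open>Gam_eq_of_full_dim\<close>).  Applied to \<open>S(\<phi>)\<close>, this shows
  that cells of \<open>S(\<rho>)\<close> that meet \<open>D\<close> in such a point lie inside \<open>D\<close>, with components inside the \<open>D\<^sub>i\<close>;
  applied to the subdivision of \<open>D\<close>, it identifies its full-dimensional cells with cells of \<open>S(\<rho>)\<close>
  that have the same components.  This gives tightness.  It also shows that a cell of the
  subdivision of \<open>D\<close> with smaller dimension contains no relatively interior point of an \<open>n\<close>-cell of
  \<open>S(\<rho>)\<close>, so the \<open>(n-1)\<close>-skeleton of the subdivision of \<open>D\<close> lies in that of \<open>S(\<rho>)\<close>, which gives
  genericity.
\<close>

section \<open>Lower boundaries of convex hulls of finite sets\<close>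

text \<open>
  The generators are points of \<open>E \<times> \<real>\<close>, not a function on a finite subset of \<open>E\<close>, because a sum of
  generating sets may contain several points above the same element of \<open>E\<close>.
\<close>
definition lower_boundary ::
  "('a::euclidean_space \<times> real) set \<Rightarrow> 'a set \<Rightarrow> ('a \<Rightarrow> real) \<Rightarrow> bool" where
  "lower_boundary S P f \<longleftrightarrow>
     finite S \<and> P = fst ` (convex hull S) \<and>
     (\<forall>x\<in>P. (x, f x) \<in> convex hull S \<and> (\<forall>z. (x, z) \<in> convex hull S \<longrightarrow> f x \<le> z))"

lemma lower_boundaryD:
  assumes "lower_boundary S P f"
  shows "finite S" "P = fst ` (convex hull S)"
    and "x \<in> P \<Longrightarrow> (x, f x) \<in> convex hull S"
    and "(x, z) \<in> convex hull S \<Longrightarrow> x \<in> P"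
    and "(x, z) \<in> convex hull S \<Longrightarrow> f x \<le> z"
  using assms by (force simp: lower_boundary_def)+

lemma cpa_defined_onE:
  assumes "cpa_defined_on A P f"
  obtains \<nu> where "lower_boundary ((\<lambda>a. (a, \<nu> a)) ` A) P f"
proof -
  from assms obtain \<nu> where fin: "finite A" and P: "P = convex hull A"
    and \<nu>: "\<forall>x\<in>P. (x, f x) \<in> convex hull ((\<lambda>a. (a, \<nu> a)) ` A) \<and>
        (\<forall>z. (x, z) \<in> convex hull ((\<lambda>a. (a, \<nu> a)) ` A) \<longrightarrow> f x \<le> z)"
    unfolding cpa_defined_on_def by blast
  have "fst ` (convex hull ((\<lambda>a. (a, \<nu> a)) ` A)) = convex hull A"
    by (simp add: convex_hull_linear_image linear_fst image_image)
  with fin P \<nu> show thesis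
    by (intro that[of \<nu>]) (auto simp: lower_boundary_def)
qed

text \<open>
  The vertices of the pieces, lifted to the graph, generate: convexity keeps their hull above the
  graph, and affinity on each piece puts every graph point in the hull.
\<close>
lemma convex_piecewise_affine_onE:
  fixes P :: "'a::euclidean_space set"
  assumes "convex_piecewise_affine_on P f"
  obtains S where "lower_boundary S P f"
proof -
  from assms obtain \<Q> where conv: "convex_on P f" and fin: "finite \<Q>" and un: "\<Union>\<Q> = P"
    and poly: "\<And>Q. Q \<in> \<Q> \<Longrightarrow> polytope Q"
    and aff: "\<And>Q. Q \<in> \<Q> \<Longrightarrow> \<exists>v c. \<forall>x\<in>Q. f x = v \<bullet> x + c"
    unfolding convex_piecewise_affine_on_def by blast
  obtain V where V: "\<And>Q. Q \<in> \<Q> \<Longrightarrow> finite (V Q) \<and> Q = convex hull (V Q)"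
    using poly unfolding polytope_def by metis
  define S where "S = (\<lambda>x. (x, f x)) ` (\<Union>Q\<in>\<Q>. V Q)"
  have VP: "V Q \<subseteq> P" if "Q \<in> \<Q>" for Q
    using that V[OF that] un hull_subset[of "V Q" convex] by blast
  have "S \<subseteq> epigraph P f"
    using VP by (fastforce simp: S_def epigraph_def)
  then have above: "convex hull S \<subseteq> epigraph P f"
    by (intro hull_minimal) (simp_all add: conv convex_epigraph)
  have graph: "(x, f x) \<in> convex hull S" if "x \<in> P" for x
  proof -
    obtain Q where Q: "Q \<in> \<Q>" "x \<in> Q" using un \<open>x \<in> P\<close> by blast
    obtain v c where vc: "\<And>y. y \<in> Q \<Longrightarrow> f y = v \<bullet> y + c" using aff[OF Q(1)] by blast
    define h where "h = (\<lambda>y. (y, v \<bullet> y))"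
    have lin: "linear h"
      by (auto simp: h_def linear_iff inner_right_distrib)
    have VQ: "V Q \<subseteq> Q" using V[OF Q(1)] hull_subset by metis
    have "(\<lambda>y. (0, c) + h y) ` V Q \<subseteq> S"
      using VQ vc Q(1) by (force simp: h_def S_def)
    then have "convex hull ((\<lambda>y. (0, c) + h y) ` V Q) \<subseteq> convex hull S"
      by (rule hull_mono)
    moreover have "convex hull ((\<lambda>y. (0, c) + h y) ` V Q) = (\<lambda>y. (0, c) + h y) ` Q"
      using V[OF Q(1)] convex_hull_translation[of "(0, c)" "h ` V Q"]
        convex_hull_linear_image[OF lin, of "V Q"]
      by (metis image_image)
    ultimately show ?thesis
      using Q vc by (force simp: h_def)
  qed
  have "lower_boundary S P f"
    unfolding lower_boundary_def
  proof (intro conjI ballI allI impI)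
    show "finite S" using fin V by (auto simp: S_def)
    show "P = fst ` (convex hull S)"
      using above graph by (force simp: epigraph_def)
    show "(x, f x) \<in> convex hull S" if "x \<in> P" for x using graph that .
    show "f x \<le> z" if "(x, z) \<in> convex hull S" for x z
      using above that by (auto simp: epigraph_def)
  qed
  then show thesis by (rule that)
qed

lemma lower_boundary_le_affine:
  assumes "lower_boundary S P f" and "\<And>a z. (a, z) \<in> S \<Longrightarrow> m \<le> z + t \<bullet> a"
    and "(y, z) \<in> convex hull S"
  shows "m \<le> z + t \<bullet> y"
proof -
  have "convex {p. (t, 1::real) \<bullet> p \<ge> m}" by (rule convex_halfspace_ge)
  moreover have "S \<subseteq> {p. (t, 1) \<bullet> p \<ge> m}" using assms(2) by (force simp: algebra_simps)
  ultimately have "convex hull S \<subseteq> {p. (t, 1) \<bullet> p \<ge> m}" by (rule hull_minimal[rotated])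
  with assms(3) show ?thesis by (auto simp: algebra_simps)
qed

lemma convex_hull_minimal_face:
  fixes S :: "'b::euclidean_space set"
  assumes fin: "finite S" and x: "x \<in> convex hull S" and min: "\<And>s. s \<in> S \<Longrightarrow> u \<bullet> x \<le> u \<bullet> s"
  shows "x \<in> convex hull {s \<in> S. u \<bullet> s = u \<bullet> x}"
proof -
  have "convex hull S \<subseteq> {p. u \<bullet> p \<ge> u \<bullet> x}"
    using min by (intro hull_minimal convex_halfspace_ge) auto
  then have "(convex hull S \<inter> {p. u \<bullet> p = u \<bullet> x}) face_of convex hull S"
    by (intro face_of_Int_supporting_hyperplane_ge) auto
  then obtain S' where S': "S' \<subseteq> S" "convex hull S \<inter> {p. u \<bullet> p = u \<bullet> x} = convex hull S'"
    using face_of_convex_hull_subset finite_imp_compact[OF fin] by metis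
  have "S' \<subseteq> {s \<in> S. u \<bullet> s = u \<bullet> x}"
    using S' hull_subset[of S' convex] by blast
  then show ?thesis using S' x hull_mono by blast
qed

text \<open>
  A lowest generator for the linear functional \<open>z + t \<bullet> a\<close> lies on the graph of \<open>f\<close>.
\<close>
lemma Gam_nonempty:
  assumes lb: "lower_boundary S P f" and "P \<noteq> {}"
  shows "Gam P f t \<noteq> {}"
proof -
  have "S \<noteq> {}" "finite S" using assms by (auto simp: lower_boundary_def)
  then obtain p where p: "p \<in> S" "\<And>q. q \<in> S \<Longrightarrow> snd p + t \<bullet> fst p \<le> snd q + t \<bullet> fst q"
    using ex_min_if_finite[of "(\<lambda>q. snd q + t \<bullet> fst q) ` S"] by (force simp: not_less)
  have le: "snd p + t \<bullet> fst p \<le> z + t \<bullet> y" if "(y, z) \<in> convex hull S" for y z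
    using p(2) by (intro lower_boundary_le_affine[OF lb _ that]) force
  have pS: "(fst p, snd p) \<in> convex hull S" using p(1) by (simp add: hull_inc)
  have "fst p \<in> Gam P f t"
    unfolding Gam_def
    using lower_boundaryD(4,5)[OF lb pS] le lower_boundaryD(3)[OF lb] by force
  then show ?thesis by blast
qed

text \<open>
  A convex function on a polytope may fail to have a subgradient at a boundary point, so finiteness
  matters here.  The convex cone spanned by the generators, seen from the point \<open>(x, f x)\<close>, is
  closed because it is finitely generated, and it misses the downward direction because
  \<open>(x, f x)\<close> is lowest in its fibre.  A hyperplane that separates the two is not vertical, and its
  slope is the subgradient.
\<close>
lemma lower_boundary_subgradient:
  assumes lb: "lower_boundary S P f" and x: "x \<in> P"
  obtains t where "x \<in> Gam P f t"
proof -
  let ?p = "(x, f x)" and ?down = "(0::'a, -1::real)"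
  define T where "T = (\<lambda>q. - ?p + q) ` S"
  let ?K = "convex_cone hull T"
  have fin: "finite T" using lb by (simp add: T_def lower_boundary_def)
  have ne: "T \<noteq> {}" using lb x by (auto simp: T_def lower_boundary_def)
  have "?down \<notin> ?K"
  proof
    assume "?down \<in> ?K"
    then obtain q c where q: "q \<in> convex hull T" and "c \<ge> 0" and c: "?down = c *\<^sub>R q"
      unfolding convex_cone_hull_convex_hull_nonempty[OF ne] by auto
    have "c \<noteq> 0" using c by (auto simp: zero_prod_def)
    with \<open>c \<ge> 0\<close> have "c > 0" by simp
    obtain s where s: "s \<in> convex hull S" "q = - ?p + s"
      using q unfolding T_def convex_hull_translation by blast
    have "fst s = x" "c * (snd s - f x) = -1"
      using c \<open>c > 0\<close> s(2) by (auto simp: prod_eq_iff)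
    moreover have "f x \<le> snd s"
      using lower_boundaryD(5)[OF lb, of x "snd s"] s(1) \<open>fst s = x\<close> by auto
    ultimately show False
      using \<open>c > 0\<close> by (smt (verit) mult_nonneg_nonneg)
  qed
  then obtain w b where wb: "w \<bullet> ?down < b" "\<And>q. q \<in> ?K \<Longrightarrow> w \<bullet> q > b"
    using separating_hyperplane_closed_point[OF convex_convex_cone_hull closed_convex_cone_hull[OF fin]]
    by metis
  \<comment> \<open>The bound \<open>b\<close> may be replaced by \<open>0\<close>, since the cone is stable under scaling.\<close>
  have "b < 0" using wb(2)[OF convex_cone_hull_contains_0] by simp
  with wb(1) have w2: "snd w > 0" by (cases w) auto
  have nonneg: "w \<bullet> q \<ge> 0" if "q \<in> ?K" for q
  proof (rule ccontr)
    assume "\<not> w \<bullet> q \<ge> 0"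
    then have "(b / (w \<bullet> q)) *\<^sub>R q \<in> ?K"
      using \<open>b < 0\<close> that by (intro convex_cone_hull_mul) (auto simp: divide_nonpos_nonpos)
    from wb(2)[OF this] \<open>\<not> w \<bullet> q \<ge> 0\<close> show False by simp
  qed
  define t where "t = fst w /\<^sub>R snd w"
  have "f x + t \<bullet> x \<le> z + t \<bullet> a" if "(a, z) \<in> S" for a z
  proof -
    have "(a, z) - ?p \<in> ?K"
      using that by (intro hull_inc) (force simp: T_def)
    from nonneg[OF this] have "0 \<le> fst w \<bullet> (a - x) + snd w * (z - f x)"
      by (cases w) simp
    then have "0 \<le> (fst w \<bullet> (a - x) + snd w * (z - f x)) / snd w"
      using w2 by simp
    also have "\<dots> = t \<bullet> (a - x) + (z - f x)"
      using w2 by (simp add: t_def field_simps)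
    finally show ?thesis by (simp add: inner_diff_right)
  qed
  from lower_boundary_le_affine[OF lb this] have "x \<in> Gam P f t"
    using x lower_boundaryD(3)[OF lb] by (auto simp: Gam_def)
  then show thesis by (rule that)
qed

text \<open>
  Cells are projections of faces of the convex hull of the generators: a representation of a point that
  minimises the functional \<open>(t, 1)\<close> uses only generators that minimise it.
\<close>
lemma lower_boundary_minimal_generators:
  assumes lb: "lower_boundary S P f" and x: "x \<in> Gam P f t"
  shows "(x, f x) \<in> convex hull {p \<in> S. fst p \<in> Gam P f t \<and> snd p = f (fst p)}"
proof -
  have xP: "x \<in> P" and le: "\<And>y. y \<in> P \<Longrightarrow> f x + t \<bullet> x \<le> f y + t \<bullet> y"
    using x by (auto simp: Gam_def)
  have min: "(t, 1) \<bullet> (x, f x) \<le> (t, 1) \<bullet> p" if "p \<in> S" for p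
  proof -
    have "(fst p, snd p) \<in> convex hull S" using that by (simp add: hull_inc)
    from lower_boundaryD(4,5)[OF lb this] le[of "fst p"] show ?thesis
      by (cases p) (simp add: algebra_simps)
  qed
  have "(x, f x) \<in> convex hull {p \<in> S. (t, 1) \<bullet> p = (t, 1) \<bullet> (x, f x)}"
    using lower_boundaryD(1,3)[OF lb] xP min by (intro convex_hull_minimal_face) auto
  moreover have "fst p \<in> Gam P f t \<and> snd p = f (fst p)"
    if "p \<in> S" and eq: "(t, 1) \<bullet> p = (t, 1) \<bullet> (x, f x)" for p
  proof -
    have "(fst p, snd p) \<in> convex hull S" using that by (simp add: hull_inc)
    from lower_boundaryD(4,5)[OF lb this] have p: "fst p \<in> P" "f (fst p) \<le> snd p" .
    have "snd p + t \<bullet> fst p = f x + t \<bullet> x" using eq by (cases p) simp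
    with p le[OF p(1)] le show ?thesis by (force simp: Gam_def)
  qed
  ultimately show ?thesis
    by (elim rev_subsetD) (intro hull_mono, blast)
qed

lemma convex_Gam:
  assumes lb: "lower_boundary S P f"
  shows "convex (Gam P f t)"
proof (cases "Gam P f t = {}")
  case False
  then obtain x where x: "x \<in> Gam P f t" by blast
  let ?m = "f x + t \<bullet> x"
  have eq: "Gam P f t = fst ` (convex hull S \<inter> {p. (t, 1) \<bullet> p = ?m})"
  proof (intro equalityI subsetI)
    fix y assume y: "y \<in> Gam P f t"
    then have "f y + t \<bullet> y = ?m" using x by (force simp: Gam_def)
    moreover have "(y, f y) \<in> convex hull S" using y lower_boundaryD(3)[OF lb] by (auto simp: Gam_def)
    ultimately show "y \<in> fst ` (convex hull S \<inter> {p. (t, 1) \<bullet> p = ?m})" by force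
  next
    fix y assume "y \<in> fst ` (convex hull S \<inter> {p. (t, 1) \<bullet> p = ?m})"
    then obtain z where z: "(y, z) \<in> convex hull S" "z + t \<bullet> y = ?m" by auto
    with lower_boundaryD(4,5)[OF lb z(1)] x show "y \<in> Gam P f t"
      by (force simp: Gam_def)
  qed
  show ?thesis unfolding eq
    by (intro convex_linear_image convex_Int convex_convex_hull convex_hyperplane linear_fst)
qed auto

text \<open>
  Let \<open>u\<close> define a supporting hyperplane of the cell at \<open>x\<close>.  Tilting the direction from \<open>t\<close> to
  \<open>t + e *\<^sub>R u\<close> for small \<open>e > 0\<close> selects the face of the cell in which \<open>u\<close> is minimal: as there are
  finitely many generators, those above other points stay strictly higher for small \<open>e\<close>.
\<close>
lemma Gam_proper_face:
  assumes lb: "lower_boundary S P f" and x: "x \<in> Gam P f t"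
    and nri: "x \<notin> rel_interior (Gam P f t)"
  obtains t' where "x \<in> Gam P f t'" "aff_dim (Gam P f t') < aff_dim (Gam P f t)"
proof -
  let ?E = "Gam P f t"
  let ?m = "f x + t \<bullet> x"
  have xP: "x \<in> P" and le: "\<And>y. y \<in> P \<Longrightarrow> ?m \<le> f y + t \<bullet> y"
    using x by (auto simp: Gam_def)
  obtain u where u: "\<And>y. y \<in> ?E \<Longrightarrow> u \<bullet> x \<le> u \<bullet> y"
    and u': "\<And>y. y \<in> rel_interior ?E \<Longrightarrow> u \<bullet> x < u \<bullet> y"
    using supporting_hyperplane_rel_boundary[OF convex_Gam[OF lb] x nri] by metis
  have gen: "?m \<le> snd p + t \<bullet> fst p" 
    and genE: "snd p + t \<bullet> fst p = ?m \<Longrightarrow> fst p \<in> ?E" if "p \<in> S" for p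
  proof -
    have "(fst p, snd p) \<in> convex hull S" using that by (simp add: hull_inc)
    from lower_boundaryD(4,5)[OF lb this] have p: "fst p \<in> P" "f (fst p) \<le> snd p" .
    show "?m \<le> snd p + t \<bullet> fst p" using le[OF p(1)] p(2) by simp
    show "fst p \<in> ?E" if "snd p + t \<bullet> fst p = ?m"
      using p le that by (force simp: Gam_def)
  qed
  have "\<forall>\<^sub>F e in at_right 0. \<forall>p\<in>S. snd p + t \<bullet> fst p > ?m \<longrightarrow>
      (snd p + t \<bullet> fst p - ?m) + e * (u \<bullet> fst p - u \<bullet> x) > 0"
  proof (intro eventually_ball_finite ballI)
    show "finite S" using lb by (simp add: lower_boundary_def)
    fix p
    have "((\<lambda>e. (snd p + t \<bullet> fst p - ?m) + e * (u \<bullet> fst p - u \<bullet> x)) \<longlongrightarrow>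
        (snd p + t \<bullet> fst p - ?m) + 0 * (u \<bullet> fst p - u \<bullet> x)) (at_right (0::real))"
      by (intro tendsto_intros)
    then show "\<forall>\<^sub>F e in at_right 0. snd p + t \<bullet> fst p > ?m \<longrightarrow>
      (snd p + t \<bullet> fst p - ?m) + e * (u \<bullet> fst p - u \<bullet> x) > 0"
      by (cases "snd p + t \<bullet> fst p > ?m") (auto dest!: order_tendstoD(1)[where a = 0])
  qed
  moreover have "\<forall>\<^sub>F e in at_right (0::real). e > 0"
    by (rule eventually_at_right_less)
  ultimately have "\<forall>\<^sub>F e in at_right 0. e > 0 \<and> (\<forall>p\<in>S. snd p + t \<bullet> fst p > ?m \<longrightarrow>
      (snd p + t \<bullet> fst p - ?m) + e * (u \<bullet> fst p - u \<bullet> x) > 0)"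
    by eventually_elim auto
  then obtain e :: real where e: "e > 0" and ep: "\<And>p. p \<in> S \<Longrightarrow> snd p + t \<bullet> fst p > ?m \<Longrightarrow>
      (snd p + t \<bullet> fst p - ?m) + e * (u \<bullet> fst p - u \<bullet> x) > 0"
    using eventually_happens by (metis (mono_tags, lifting) trivial_limit_at_right_real)
  define t' where "t' = t + e *\<^sub>R u"
  let ?m' = "f x + t' \<bullet> x"
  have genle: "?m' \<le> snd p + t' \<bullet> fst p" if "p \<in> S" for p
  proof (cases "snd p + t \<bullet> fst p = ?m")
    case True
    have "e * (u \<bullet> x) \<le> e * (u \<bullet> fst p)"
      using u[OF genE[OF that True]] e by simp
    with True show ?thesis by (simp add: t'_def inner_add_left)
  next
    case False
    with ep[OF that] gen[OF that]
    have "(snd p + t \<bullet> fst p - ?m) + (e * (u \<bullet> fst p) - e * (u \<bullet> x)) > 0"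
      by (simp add: right_diff_distrib)
    then show ?thesis by (simp add: t'_def inner_add_left)
  qed
  have xE': "x \<in> Gam P f t'"
    unfolding Gam_def
  proof (intro CollectI conjI ballI xP)
    fix y assume "y \<in> P"
    then have "(y, f y) \<in> convex hull S" by (rule lower_boundaryD(3)[OF lb])
    then show "?m' \<le> f y + t' \<bullet> y"
    proof (rule lower_boundary_le_affine[OF lb, rotated])
      show "?m' \<le> z + t' \<bullet> a" if "(a, z) \<in> S" for a z
        using genle[OF that] by simp
    qed
  qed
  have geneq: "fst p \<in> ?E \<inter> {y. u \<bullet> y = u \<bullet> x}"
    if p: "p \<in> S" "fst p \<in> Gam P f t'" "snd p = f (fst p)" for p
  proof -
    have eq: "snd p + t' \<bullet> fst p = ?m'"
      using p xE' by (auto simp: Gam_def intro: antisym)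
    have eq': "(snd p + t \<bullet> fst p - ?m) + e * (u \<bullet> fst p - u \<bullet> x) = 0"
      using eq by (simp add: t'_def inner_add_left right_diff_distrib)
    have "snd p + t \<bullet> fst p = ?m"
    proof (rule ccontr)
      assume "snd p + t \<bullet> fst p \<noteq> ?m"
      with gen[OF p(1)] ep[OF p(1)] eq' show False
        by simp
    qed
    with eq' genE[OF p(1)] e show ?thesis
      by simp
  qed
  have cF: "convex (?E \<inter> {y. u \<bullet> y = u \<bullet> x})"
    by (intro convex_Int convex_Gam[OF lb] convex_hyperplane)
  have sub: "Gam P f t' \<subseteq> ?E \<inter> {y. u \<bullet> y = u \<bullet> x}"
  proof
    fix y assume "y \<in> Gam P f t'"
    from lower_boundary_minimal_generators[OF lb this]
    have "y \<in> fst ` (convex hull {p \<in> S. fst p \<in> Gam P f t' \<and> snd p = f (fst p)})"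
      by force
    also have "\<dots> = convex hull (fst ` {p \<in> S. fst p \<in> Gam P f t' \<and> snd p = f (fst p)})"
      by (simp add: convex_hull_linear_image linear_fst)
    also have "\<dots> \<subseteq> ?E \<inter> {y. u \<bullet> y = u \<bullet> x}"
      using geneq by (intro hull_minimal cF) blast
    finally show "y \<in> ?E \<inter> {y. u \<bullet> y = u \<bullet> x}" .
  qed
  have face: "(?E \<inter> {y. u \<bullet> y = u \<bullet> x}) face_of ?E"
    using u by (intro face_of_Int_supporting_hyperplane_ge convex_Gam[OF lb]) auto
  obtain y where "y \<in> rel_interior ?E"
    using rel_interior_eq_empty[OF convex_Gam[OF lb]] x by blast
  then have "y \<in> ?E - {y. u \<bullet> y = u \<bullet> x}"
    using u'[of y] rel_interior_subset by auto
  then have "?E \<inter> {y. u \<bullet> y = u \<bullet> x} \<noteq> ?E" by blast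
  with face have "aff_dim (?E \<inter> {y. u \<bullet> y = u \<bullet> x}) < aff_dim ?E"
    by (rule face_of_aff_dim_lt[OF convex_Gam[OF lb]])
  then have "aff_dim (Gam P f t') < aff_dim ?E"
    using aff_dim_subset[OF sub] by linarith
  with xE' show thesis by (rule that)
qed

lemma Gam_restrict:
  assumes "Q \<subseteq> P" "Gam P f t \<subseteq> Q" "Gam P f t \<noteq> {}"
  shows "Gam Q f t = Gam P f t"
proof -
  obtain a where a: "a \<in> Gam P f t" using assms(3) by blast
  then have "a \<in> Q" using assms(2) by blast
  show ?thesis
  proof (intro equalityI subsetI)
    fix x assume x: "x \<in> Gam Q f t"
    then have "f x + t \<bullet> x \<le> f a + t \<bullet> a" "x \<in> P" using \<open>a \<in> Q\<close> assms(1) by (auto simp: Gam_def)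
    with a show "x \<in> Gam P f t" by (force simp: Gam_def)
  next
    fix x assume "x \<in> Gam P f t"
    then show "x \<in> Gam Q f t" using assms(1,2) by (auto simp: Gam_def)
  qed
qed

section \<open>Cells that share a relatively interior point\<close>

lemma minimum_at_rel_interior_orthogonal:
  fixes T L :: "'a::euclidean_space set"
  assumes L: "subspace L" and T: "T \<subseteq> L" "aff_dim T = aff_dim L" "convex T"
    and x: "x \<in> rel_interior T" and min: "\<And>y. y \<in> T \<Longrightarrow> u \<bullet> x \<le> u \<bullet> y" and z: "z \<in> L"
  shows "u \<bullet> z = 0"
proof -
  have "T \<noteq> {}" using x rel_interior_subset by blast
  have "u \<bullet> y = u \<bullet> x" if y: "y \<in> T" for y
  proof -
    obtain e where e: "e > 1" "(1 - e) *\<^sub>R y + e *\<^sub>R x \<in> T"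
      using x y convex_rel_interior_iff[OF T(3) \<open>T \<noteq> {}\<close>] by blast
    from min[OF e(2)] have "0 \<le> (e - 1) * (u \<bullet> x - u \<bullet> y)"
      by (simp add: inner_add_right algebra_simps)
    then have "u \<bullet> y \<le> u \<bullet> x" using e(1) by (simp add: zero_le_mult_iff)
    with min[OF y] show ?thesis by simp
  qed
  then have "affine hull T \<subseteq> {y. u \<bullet> y = u \<bullet> x}"
    by (intro hull_minimal affine_hyperplane) auto
  moreover have "affine hull T = L"
    using T \<open>T \<noteq> {}\<close> subspace_imp_affine[OF L]
    by (intro affine_dim_equal) (auto simp: hull_minimal)
  ultimately have "u \<bullet> 0 = u \<bullet> x" "u \<bullet> z = u \<bullet> x"
    using subspace_0[OF L] z by auto
  then show ?thesis by simp
qed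

text \<open>
  On \<open>T\<close> the function \<open>f + v\<close> is constant, so \<open>f + v'\<close> differs from \<open>v' - v\<close> by a constant there.
  The minimum of \<open>f + v'\<close> at \<open>x\<close> is thus a minimum of a linear form at a relatively interior point.
\<close>
lemma Gam_eq_of_full_dim:
  fixes P L :: "'a::euclidean_space set"
  assumes L: "subspace L" and P: "P \<subseteq> L"
    and T: "T \<subseteq> Gam P f v" "aff_dim T = aff_dim L" "convex T"
    and x: "x \<in> rel_interior T" "x \<in> Gam P f v'"
  shows "Gam P f v' = Gam P f v"
proof -
  have xT: "x \<in> T" using x rel_interior_subset by blast
  have TL: "T \<subseteq> L" using T(1) P by (auto simp: Gam_def)
  have min: "(v' - v) \<bullet> x \<le> (v' - v) \<bullet> y" if "y \<in> T" for y
  proof -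
    have "y \<in> P" "x \<in> P" "y \<in> Gam P f v" "x \<in> Gam P f v"
      using that xT T(1) by (auto simp: Gam_def)
    then have "f y + v \<bullet> y = f x + v \<bullet> x" "f x + v' \<bullet> x \<le> f y + v' \<bullet> y"
      using x(2) by (auto simp: Gam_def intro: antisym)
    then show ?thesis by (simp add: inner_diff_left)
  qed
  have "v' \<bullet> z = v \<bullet> z" if "z \<in> P" for z
    using minimum_at_rel_interior_orthogonal[OF L TL T(2,3) x(1) min, of z] that P
    by (auto simp: inner_diff_left)
  then show ?thesis by (auto simp: Gam_def)
qed

section \<open>Inf-convolutions and components\<close>

lemma sum_mem_sum_sets:
  fixes n :: nat and X :: "nat \<Rightarrow> 'b::comm_monoid_add set"
  assumes "\<And>i. i \<le> n \<Longrightarrow> y i \<in> X i"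
  shows "(\<Sum>i\<le>n. y i) \<in> (\<Sum>i\<le>n. X i)"
  using assms by (auto simp: set_sum_alt)

lemma sum_setsE:
  fixes n :: nat and X :: "nat \<Rightarrow> 'b::comm_monoid_add set"
  assumes "x \<in> (\<Sum>i\<le>n. X i)"
  obtains y where "\<And>i. i \<le> n \<Longrightarrow> y i \<in> X i" "(\<Sum>i\<le>n. y i) = x"
  using assms by (auto simp: set_sum_alt)

locale polyhedral_family =
  fixes n :: nat and \<Delta> :: "nat \<Rightarrow> 'a::euclidean_space set" and f :: "nat \<Rightarrow> 'a \<Rightarrow> real"
  assumes lower_boundary_ex: "i \<le> n \<Longrightarrow> \<exists>S. lower_boundary S (\<Delta> i) (f i)"
    and domain_nonempty: "i \<le> n \<Longrightarrow> \<Delta> i \<noteq> {}"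
begin

abbreviation "Dom \<equiv> \<Sum>i\<le>n. \<Delta> i"
abbreviation "Conv \<equiv> inf_conv n \<Delta> f"

text \<open>
  The Minkowski sum of the generating sets generates the inf-convolution, since taking convex hulls
  commutes with Minkowski sums.  Compactness of the hull gives a lowest point above every \<open>x\<close>, and a
  splitting of this point into summands is an optimal decomposition of \<open>x\<close>.
\<close>
lemma inf_conv_polyhedral:
  shows "(\<exists>S. lower_boundary S Dom Conv) \<and>
    (\<forall>x\<in>Dom. \<exists>y. (\<forall>i\<le>n. y i \<in> \<Delta> i) \<and> (\<Sum>i\<le>n. y i) = x \<and> Conv x = (\<Sum>i\<le>n. f i (y i))) \<and>
    (\<forall>y. (\<forall>i\<le>n. y i \<in> \<Delta> i) \<longrightarrow> Conv (\<Sum>i\<le>n. y i) \<le> (\<Sum>i\<le>n. f i (y i)))"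
proof -
  obtain S where lb: "\<And>i. i \<le> n \<Longrightarrow> lower_boundary (S i) (\<Delta> i) (f i)"
    using lower_boundary_ex by metis
  let ?K = "convex hull (\<Sum>i\<le>n. S i)"
  have fin: "finite (\<Sum>i\<le>n. S i)"
    using lower_boundaryD(1)[OF lb] by (intro finite_set_sum) auto
  have graph: "(\<Sum>i\<le>n. y i, \<Sum>i\<le>n. f i (y i)) \<in> ?K" if "\<forall>i\<le>n. y i \<in> \<Delta> i" for y
  proof -
    have "(\<Sum>i\<le>n. (y i, f i (y i))) \<in> (\<Sum>i\<le>n. convex hull (S i))"
      using that by (intro sum_mem_sum_sets lower_boundaryD(3)[OF lb]) auto
    then show ?thesis by (simp add: convex_hull_set_sum sum_prod)
  qed
  have above: "\<exists>y. (\<forall>i\<le>n. y i \<in> \<Delta> i) \<and> (\<Sum>i\<le>n. y i) = x \<and> (\<Sum>i\<le>n. f i (y i)) \<le> z"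
    if xz: "(x, z) \<in> ?K" for x z
  proof -
    obtain p where p: "\<And>i. i \<le> n \<Longrightarrow> p i \<in> convex hull (S i)" "(\<Sum>i\<le>n. p i) = (x, z)"
      using xz unfolding convex_hull_set_sum by (rule sum_setsE) (rule that)
    have *: "fst (p i) \<in> \<Delta> i" "f i (fst (p i)) \<le> snd (p i)" if "i \<le> n" for i
      using lower_boundaryD(4,5)[OF lb[OF that], of "fst (p i)" "snd (p i)"] p(1) that by auto
    have "(\<Sum>i\<le>n. fst (p i)) = x" "(\<Sum>i\<le>n. snd (p i)) = z"
      using p(2) by (simp_all flip: fst_sum snd_sum)
    moreover have "(\<Sum>i\<le>n. f i (fst (p i))) \<le> (\<Sum>i\<le>n. snd (p i))"
      using * by (intro sum_mono) auto
    ultimately show ?thesis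
      using *(1) by (intro exI[of _ "\<lambda>i. fst (p i)"]) simp
  qed
  have best: "\<exists>y. (\<forall>i\<le>n. y i \<in> \<Delta> i) \<and> (\<Sum>i\<le>n. y i) = x \<and>
      (\<forall>z. (x, z) \<in> ?K \<longrightarrow> (\<Sum>i\<le>n. f i (y i)) \<le> z)" if x: "x \<in> Dom" for x
  proof -
    let ?Z = "snd ` (?K \<inter> fst -` {x})"
    have "compact (?K \<inter> fst -` {x})"
      by (intro compact_Int_closed finite_imp_compact_convex_hull fin closed_vimage_fst closed_singleton)
    then have "compact ?Z"
      by (intro compact_continuous_image continuous_on_snd continuous_on_id)
    moreover have "?Z \<noteq> {}"
    proof -
      obtain y where y: "\<And>i. i \<le> n \<Longrightarrow> y i \<in> \<Delta> i" "(\<Sum>i\<le>n. y i) = x"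
        using x by (rule sum_setsE) (rule that)
      then have "(x, \<Sum>i\<le>n. f i (y i)) \<in> ?K" using graph[of y] by simp
      then show ?thesis by auto
    qed
    ultimately obtain z where z: "z \<in> ?Z" "\<And>z'. z' \<in> ?Z \<Longrightarrow> z \<le> z'"
      using compact_attains_inf[of ?Z] by blast
    have "(x, z) \<in> ?K" using z(1) by auto
    from above[OF this] obtain y where y: "\<forall>i\<le>n. y i \<in> \<Delta> i" "(\<Sum>i\<le>n. y i) = x"
      "(\<Sum>i\<le>n. f i (y i)) \<le> z" by blast
    have "z \<le> z'" if "(x, z') \<in> ?K" for z'
      using that by (intro z(2)) force
    with y show ?thesis by (intro exI[of _ y]) (auto intro: order_trans)
  qed
  have inf_conv: "\<exists>y. (\<forall>i\<le>n. y i \<in> \<Delta> i) \<and> (\<Sum>i\<le>n. y i) = x \<and> Conv x = (\<Sum>i\<le>n. f i (y i)) \<and>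
      (\<forall>z. (x, z) \<in> ?K \<longrightarrow> Conv x \<le> z)" if x: "x \<in> Dom" for x
  proof -
    obtain y where y: "\<forall>i\<le>n. y i \<in> \<Delta> i" "(\<Sum>i\<le>n. y i) = x"
      and ymin: "\<And>z. (x, z) \<in> ?K \<Longrightarrow> (\<Sum>i\<le>n. f i (y i)) \<le> z"
      using best[OF x] by blast
    have "Conv x = (\<Sum>i\<le>n. f i (y i))"
      unfolding inf_conv_def
    proof (rule cInf_eq_minimum)
      show "(\<Sum>i\<le>n. f i (y i)) \<in>
          {\<Sum>i\<le>n. f i (y i) |y. (\<forall>i\<le>n. y i \<in> \<Delta> i) \<and> (\<Sum>i\<le>n. y i) = x}"
        using y by blast
      fix z assume "z \<in> {\<Sum>i\<le>n. f i (y i) |y. (\<forall>i\<le>n. y i \<in> \<Delta> i) \<and> (\<Sum>i\<le>n. y i) = x}"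
      then obtain w where w: "\<forall>i\<le>n. w i \<in> \<Delta> i" "(\<Sum>i\<le>n. w i) = x" "z = (\<Sum>i\<le>n. f i (w i))"
        by blast
      then show "(\<Sum>i\<le>n. f i (y i)) \<le> z" using graph[OF w(1)] ymin[of z] by simp
    qed
    with y ymin show ?thesis by (intro exI[of _ y]) auto
  qed
  have "lower_boundary (\<Sum>i\<le>n. S i) Dom Conv"
    unfolding lower_boundary_def
  proof (intro conjI ballI fin allI impI)
    show graph': "(x, Conv x) \<in> ?K" if x: "x \<in> Dom" for x
    proof -
      obtain y where "\<forall>i\<le>n. y i \<in> \<Delta> i" "(\<Sum>i\<le>n. y i) = x" "Conv x = (\<Sum>i\<le>n. f i (y i))"
        using inf_conv[OF x] by blast
      with graph[of y] show ?thesis by simp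
    qed
    show "Dom = fst ` ?K"
    proof (intro equalityI subsetI)
      show "x \<in> fst ` ?K" if "x \<in> Dom" for x using graph'[OF that] by force
      show "x \<in> Dom" if "x \<in> fst ` ?K" for x
      proof -
        obtain z where "(x, z) \<in> ?K" using \<open>x \<in> fst ` ?K\<close> by auto
        from above[OF this] obtain y where "\<forall>i\<le>n. y i \<in> \<Delta> i" "(\<Sum>i\<le>n. y i) = x" by blast
        then show ?thesis using sum_mem_sum_sets[of n y \<Delta>] by simp
      qed
    qed
    show "Conv x \<le> z" if "x \<in> Dom" "(x, z) \<in> ?K" for x z
      using inf_conv[OF that(1)] that(2) by blast
  qed
  moreover have "Conv (\<Sum>i\<le>n. y i) \<le> (\<Sum>i\<le>n. f i (y i))" if y: "\<forall>i\<le>n. y i \<in> \<Delta> i" for y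
  proof -
    have "(\<Sum>i\<le>n. y i) \<in> Dom" using y by (intro sum_mem_sum_sets) auto
    from inf_conv[OF this] graph[OF y] show ?thesis by blast
  qed
  ultimately show ?thesis using inf_conv by blast
qed

lemma inf_conv_lower_boundary: "\<exists>S. lower_boundary S Dom Conv"
  by (rule conjunct1[OF inf_conv_polyhedral])

lemma inf_conv_attained:
  assumes "x \<in> Dom"
  obtains y where "\<And>i. i \<le> n \<Longrightarrow> y i \<in> \<Delta> i" "(\<Sum>i\<le>n. y i) = x" "Conv x = (\<Sum>i\<le>n. f i (y i))"
  using conjunct1[OF conjunct2[OF inf_conv_polyhedral]] assms by blast

lemma inf_conv_le:
  assumes "\<And>i. i \<le> n \<Longrightarrow> y i \<in> \<Delta> i"
  shows "Conv (\<Sum>i\<le>n. y i) \<le> (\<Sum>i\<le>n. f i (y i))"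
  using conjunct2[OF conjunct2[OF inf_conv_polyhedral]] assms by blast

lemma Gam_selection:
  obtains a where "\<And>i. i \<le> n \<Longrightarrow> a i \<in> Gam (\<Delta> i) (f i) t"
proof -
  have "\<forall>i. \<exists>a. i \<le> n \<longrightarrow> a \<in> Gam (\<Delta> i) (f i) t"
    using lower_boundary_ex domain_nonempty Gam_nonempty by blast
  from choice[OF this] show thesis using that by blast
qed

text \<open>
  The minimum of \<open>Conv + t\<close> is the sum of the minima of the \<open>f i + t\<close>, so a sum attains it through the
  values \<open>f i (y i)\<close> exactly if each term is minimal.
\<close>
lemma Gam_sum_iff:
  assumes y: "\<And>i. i \<le> n \<Longrightarrow> y i \<in> \<Delta> i"
  shows "(\<Sum>i\<le>n. y i) \<in> Gam Dom Conv t \<and> Conv (\<Sum>i\<le>n. y i) = (\<Sum>i\<le>n. f i (y i)) \<longleftrightarrow>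
    (\<forall>i\<le>n. y i \<in> Gam (\<Delta> i) (f i) t)" (is "?lhs \<longleftrightarrow> ?rhs")
proof -
  have split: "(\<Sum>i\<le>n. f i (w i)) + t \<bullet> (\<Sum>i\<le>n. w i) = (\<Sum>i\<le>n. f i (w i) + t \<bullet> w i)" for w
    by (simp add: inner_sum_right sum.distrib)
  show ?thesis
  proof
    assume l: ?lhs
    obtain a where a: "\<And>i. i \<le> n \<Longrightarrow> a i \<in> Gam (\<Delta> i) (f i) t"
      using Gam_selection by blast
    have a\<Delta>: "\<And>i. i \<le> n \<Longrightarrow> a i \<in> \<Delta> i"
      and amin: "\<And>i z. i \<le> n \<Longrightarrow> z \<in> \<Delta> i \<Longrightarrow> f i (a i) + t \<bullet> a i \<le> f i z + t \<bullet> z"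
      using a by (auto simp: Gam_def)
    have "(\<Sum>i\<le>n. f i (y i) + t \<bullet> y i) \<le> Conv (\<Sum>i\<le>n. a i) + t \<bullet> (\<Sum>i\<le>n. a i)"
      using l sum_mem_sum_sets[of n a, OF a\<Delta>] by (auto simp: Gam_def simp flip: split)
    also have "\<dots> \<le> (\<Sum>i\<le>n. f i (a i) + t \<bullet> a i)"
      using inf_conv_le[of a, OF a\<Delta>] by (simp flip: split)
    finally have le: "(\<Sum>i\<le>n. f i (y i) + t \<bullet> y i) \<le> (\<Sum>i\<le>n. f i (a i) + t \<bullet> a i)" .
    have "f i (y i) + t \<bullet> y i = f i (a i) + t \<bullet> a i" if "i \<le> n" for i
    proof (rule ccontr)
      assume "f i (y i) + t \<bullet> y i \<noteq> f i (a i) + t \<bullet> a i"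
      then have "(\<Sum>i\<le>n. f i (a i) + t \<bullet> a i) < (\<Sum>i\<le>n. f i (y i) + t \<bullet> y i)"
        using amin y that by (intro sum_strict_mono_ex1) (auto intro!: bexI[of _ i] simp: less_le)
      with le show False by simp
    qed
    then show ?rhs using y amin by (auto simp: Gam_def)
  next
    assume r: ?rhs
    have le: "Conv (\<Sum>i\<le>n. y i) + t \<bullet> (\<Sum>i\<le>n. y i) \<le> (\<Sum>i\<le>n. f i (y i) + t \<bullet> y i)"
      using inf_conv_le[of y, OF y] by (simp flip: split)
    have ge: "(\<Sum>i\<le>n. f i (y i) + t \<bullet> y i) \<le> Conv x + t \<bullet> x" if x: "x \<in> Dom" for x
    proof -
      obtain w where w: "\<And>i. i \<le> n \<Longrightarrow> w i \<in> \<Delta> i" "(\<Sum>i\<le>n. w i) = x"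
        "Conv x = (\<Sum>i\<le>n. f i (w i))"
        using inf_conv_attained[OF x] by metis
      have "(\<Sum>i\<le>n. f i (y i) + t \<bullet> y i) \<le> (\<Sum>i\<le>n. f i (w i) + t \<bullet> w i)"
        using r w(1) by (intro sum_mono) (auto simp: Gam_def)
      then show ?thesis using w by (simp flip: split)
    qed
    have "Conv (\<Sum>i\<le>n. y i) + t \<bullet> (\<Sum>i\<le>n. y i) \<le> Conv x + t \<bullet> x" if "x \<in> Dom" for x
      using le ge[OF that] by (rule order_trans)
    moreover have "Conv (\<Sum>i\<le>n. y i) = (\<Sum>i\<le>n. f i (y i))"
      using le ge[OF sum_mem_sum_sets[of n y, OF y]] by (simp flip: split)
    ultimately show ?lhs
      using sum_mem_sum_sets[of n y, OF y] by (simp add: Gam_def)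
  qed
qed

lemma sum_Gam: "(\<Sum>i\<le>n. Gam (\<Delta> i) (f i) t) = Gam Dom Conv t"
proof (intro equalityI subsetI)
  fix x assume "x \<in> (\<Sum>i\<le>n. Gam (\<Delta> i) (f i) t)"
  then obtain y where y: "\<And>i. i \<le> n \<Longrightarrow> y i \<in> Gam (\<Delta> i) (f i) t" "(\<Sum>i\<le>n. y i) = x"
    by (rule sum_setsE) (rule that)
  then show "x \<in> Gam Dom Conv t"
    using Gam_sum_iff[of y t] by (auto simp: Gam_def)
next
  fix x assume x: "x \<in> Gam Dom Conv t"
  then have "x \<in> Dom" by (simp add: Gam_def)
  then obtain y where "\<And>i. i \<le> n \<Longrightarrow> y i \<in> \<Delta> i" "(\<Sum>i\<le>n. y i) = x"
    "Conv x = (\<Sum>i\<le>n. f i (y i))"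
    using inf_conv_attained by metis
  with x Gam_sum_iff[of y t] sum_mem_sum_sets[of n y "\<lambda>i. Gam (\<Delta> i) (f i) t"]
  show "x \<in> (\<Sum>i\<le>n. Gam (\<Delta> i) (f i) t)"
    by simp
qed

lemma component_Gam:
  assumes i: "i \<le> n"
  shows "component n \<Delta> f (Gam Dom Conv t) i = Gam (\<Delta> i) (f i) t"
proof (intro equalityI subsetI)
  fix x assume "x \<in> component n \<Delta> f (Gam Dom Conv t) i"
  then obtain y where "\<forall>j\<le>n. y j \<in> \<Delta> j" "(\<Sum>j\<le>n. y j) \<in> Gam Dom Conv t"
    "Conv (\<Sum>j\<le>n. y j) = (\<Sum>j\<le>n. f j (y j))" "x = y i"
    unfolding component_def by blast
  with Gam_sum_iff[of y t] i show "x \<in> Gam (\<Delta> i) (f i) t" by blast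
next
  fix x assume x: "x \<in> Gam (\<Delta> i) (f i) t"
  obtain a where a: "\<And>j. j \<le> n \<Longrightarrow> a j \<in> Gam (\<Delta> j) (f j) t"
    using Gam_selection by blast
  \<comment> \<open>Any point of the cell of \<open>f i\<close> is completed to an optimal sum by a selection from the other cells.\<close>
  define y where "y = a(i := x)"
  have y: "\<forall>j\<le>n. y j \<in> Gam (\<Delta> j) (f j) t" using a x by (simp add: y_def)
  then have "\<forall>j\<le>n. y j \<in> \<Delta> j" by (simp add: Gam_def)
  with y Gam_sum_iff[of y t] have "y i \<in> component n \<Delta> f (Gam Dom Conv t) i"
    unfolding component_def by blast
  then show "x \<in> component n \<Delta> f (Gam Dom Conv t) i" by (simp add: y_def)
qed

end

section \<open>Restriction to a cell of a coarser subdivision\<close>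

text \<open>
  Two successive passages to a face: \<open>x\<close> is represented by generators that lie above a cell of \<open>\<rho>\<close>, hence
  over a cell of \<open>\<phi>\<close> of some direction \<open>t'\<close>.  There \<open>\<phi> + v\<close> equals \<open>v - t'\<close> up to a constant, and \<open>x\<close>
  minimises \<open>\<phi> + v\<close>, so only the generators that minimise it too are needed.  These lie above \<open>Gam P \<phi> v\<close>.
\<close>
lemma cpa_defined_on_cell:
  assumes cpa: "cpa_defined_on A P \<rho>"
    and \<phi>: "lower_boundary T P \<phi>"
    and refine: "\<And>t. \<exists>t'. Gam P \<rho> t \<subseteq> Gam P \<phi> t'"
  shows "cpa_defined_on (A \<inter> Gam P \<phi> v) (Gam P \<phi> v) \<rho>"
proof -
  let ?D = "Gam P \<phi> v"
  obtain \<nu> where lb: "lower_boundary ((\<lambda>a. (a, \<nu> a)) ` A) P \<rho>"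
    using cpa_defined_onE[OF cpa] .
  have graph: "(x, \<rho> x) \<in> convex hull ((\<lambda>a. (a, \<nu> a)) ` (A \<inter> ?D))" if x: "x \<in> ?D" for x
  proof -
    have "x \<in> P" using x by (simp add: Gam_def)
    then obtain t where t: "x \<in> Gam P \<rho> t" using lower_boundary_subgradient[OF lb] by metis
    obtain t' where t': "Gam P \<rho> t \<subseteq> Gam P \<phi> t'" using refine by blast
    define S where "S = {p \<in> (\<lambda>a. (a, \<nu> a)) ` A. fst p \<in> Gam P \<rho> t \<and> snd p = \<rho> (fst p)}"
    have fin: "finite S"
      using lower_boundaryD(1)[OF lb] by (simp add: S_def)
    have xS: "(x, \<rho> x) \<in> convex hull S"
      using lower_boundary_minimal_generators[OF lb t] by (simp add: S_def)
    \<comment> \<open>Both \<open>a\<close> and \<open>x\<close> minimise \<open>\<phi> + t'\<close>, so \<open>\<phi>\<close> and \<open>- t'\<close> change by the same amount between them.\<close>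
    have diff: "(v - t') \<bullet> a = (\<phi> a + v \<bullet> a) - (\<phi> x + v \<bullet> x) + (v - t') \<bullet> x"
      if "a \<in> Gam P \<phi> t'" for a
    proof -
      have "\<phi> a + t' \<bullet> a = \<phi> x + t' \<bullet> x"
        using that t t' by (intro antisym) (auto simp: Gam_def)
      then show ?thesis by (simp add: inner_diff_left)
    qed
    have "(x, \<rho> x) \<in> convex hull {s \<in> S. (v - t', 0) \<bullet> s = (v - t', 0) \<bullet> (x, \<rho> x)}"
    proof (rule convex_hull_minimal_face[OF fin xS])
      fix s assume "s \<in> S"
      then have s: "fst s \<in> Gam P \<phi> t'" using t' by (auto simp: S_def)
      then have "\<phi> x + v \<bullet> x \<le> \<phi> (fst s) + v \<bullet> fst s" using x by (auto simp: Gam_def)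
      with diff[OF s] show "(v - t', 0) \<bullet> (x, \<rho> x) \<le> (v - t', 0) \<bullet> s"
        by (cases s) simp
    qed
    moreover have "{s \<in> S. (v - t', 0) \<bullet> s = (v - t', 0) \<bullet> (x, \<rho> x)} \<subseteq>
        (\<lambda>a. (a, \<nu> a)) ` (A \<inter> ?D)"
    proof
      fix s assume "s \<in> {s \<in> S. (v - t', 0) \<bullet> s = (v - t', 0) \<bullet> (x, \<rho> x)}"
      then obtain a where a: "a \<in> A" "s = (a, \<nu> a)" "a \<in> Gam P \<phi> t'"
        "(v - t') \<bullet> a = (v - t') \<bullet> x"
        using t' by (auto simp: S_def)
      from diff[OF a(3)] a(4) have "\<phi> a + v \<bullet> a = \<phi> x + v \<bullet> x" by simp
      with x a(3) have "a \<in> ?D" by (auto simp: Gam_def)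
      with a show "s \<in> (\<lambda>a. (a, \<nu> a)) ` (A \<inter> ?D)" by blast
    qed
    ultimately show ?thesis by (rule rev_subsetD[OF _ hull_mono])
  qed
  have hull: "?D = convex hull (A \<inter> ?D)"
  proof (intro equalityI subsetI)
    fix x assume "x \<in> ?D"
    from graph[OF this] have "x \<in> fst ` (convex hull ((\<lambda>a. (a, \<nu> a)) ` (A \<inter> ?D)))"
      by force
    then show "x \<in> convex hull (A \<inter> ?D)"
      by (simp add: convex_hull_linear_image linear_fst image_image)
  next
    fix x assume "x \<in> convex hull (A \<inter> ?D)"
    moreover have "convex hull (A \<inter> ?D) \<subseteq> ?D"
      by (intro hull_minimal convex_Gam[OF \<phi>]) blast
    ultimately show "x \<in> ?D" by blast
  qed
  have below: "\<rho> x \<le> z" if "(x, z) \<in> convex hull ((\<lambda>a. (a, \<nu> a)) ` (A \<inter> ?D))" for x z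
  proof -
    have "(x, z) \<in> convex hull ((\<lambda>a. (a, \<nu> a)) ` A)"
      using that by (rule rev_subsetD[OF _ hull_mono]) blast
    then show ?thesis by (rule lower_boundaryD(5)[OF lb])
  qed
  have "finite (A \<inter> ?D)" using cpa by (simp add: cpa_defined_on_def)
  with graph hull below show ?thesis
    unfolding cpa_defined_on_def by blast
qed

locale mixed_refinement =
  rho: polyhedral_family n \<Delta> \<rho> + phi: polyhedral_family n \<Delta> \<phi>
  for n :: nat and \<Delta> :: "nat \<Rightarrow> 'a::euclidean_space set" and \<rho> \<phi> :: "nat \<Rightarrow> 'a \<Rightarrow> real" +
  assumes refine: "mixed_preceq n \<Delta> \<phi> \<rho>"
begin

lemma refining_cell:
  obtains t' where "Gam rho.Dom rho.Conv t \<subseteq> Gam phi.Dom phi.Conv t'"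
    and "\<And>i. i \<le> n \<Longrightarrow> Gam (\<Delta> i) (\<rho> i) t \<subseteq> Gam (\<Delta> i) (\<phi> i) t'"
proof -
  have "Gam rho.Dom rho.Conv t \<in> mixed_subdivision n \<Delta> \<rho>"
    by (simp add: mixed_subdivision_def subdivision_def)
  with refine obtain E where E: "E \<in> mixed_subdivision n \<Delta> \<phi>" "Gam rho.Dom rho.Conv t \<subseteq> E"
    "\<And>i. i \<le> n \<Longrightarrow> component n \<Delta> \<rho> (Gam rho.Dom rho.Conv t) i \<subseteq> component n \<Delta> \<phi> E i"
    unfolding mixed_preceq_def by blast
  then obtain t' where "E = Gam phi.Dom phi.Conv t'"
    by (auto simp: mixed_subdivision_def subdivision_def)
  with E show thesis
    by (intro that[of t']) (simp_all add: rho.component_Gam phi.component_Gam)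
qed

end

text \<open>
  The family \<open>D\<close> consists of the components of the cell of direction \<open>v\<close> of the coarser subdivision, and \<open>L\<close>
  stands for \<open>span M\<close>.  That \<open>D\<close> with \<open>\<rho>\<close> is again a polyhedral family is assumed here; it follows from
  \<open>cpa_defined_on_cell\<close>.
\<close>
locale refined_cell =
  mixed_refinement n \<Delta> \<rho> \<phi> + cell: polyhedral_family n D \<rho>
  for n :: nat and \<Delta> :: "nat \<Rightarrow> 'a::euclidean_space set" and \<rho> \<phi> :: "nat \<Rightarrow> 'a \<Rightarrow> real"
    and D :: "nat \<Rightarrow> 'a set" +
  fixes v :: 'a and L :: "'a set"
  assumes cell_eq: "i \<le> n \<Longrightarrow> D i = Gam (\<Delta> i) (\<phi> i) v"
    and L: "subspace L" "aff_dim L = int n" "i \<le> n \<Longrightarrow> \<Delta> i \<subseteq> L"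
begin

lemma Dom_subset: "rho.Dom \<subseteq> L"
proof
  fix x assume "x \<in> rho.Dom"
  then obtain y where "\<And>i. i \<le> n \<Longrightarrow> y i \<in> \<Delta> i" "(\<Sum>i\<le>n. y i) = x"
    by (rule sum_setsE) (rule that)
  then show "x \<in> L" using L(3) subspace_sum[OF L(1), of "{..n}" y] by blast
qed

lemma cell_Dom: "cell.Dom = Gam phi.Dom phi.Conv v"
proof -
  have "cell.Dom = (\<Sum>i\<le>n. Gam (\<Delta> i) (\<phi> i) v)"
    by (intro sum.cong) (simp_all add: cell_eq)
  then show ?thesis by (simp add: phi.sum_Gam)
qed

lemma cell_Dom_subset: "cell.Dom \<subseteq> rho.Dom"
  by (auto simp: cell_Dom Gam_def)

lemma rho_subgradient:
  assumes "x \<in> rho.Dom"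
  obtains t where "x \<in> Gam rho.Dom rho.Conv t"
  using rho.inf_conv_lower_boundary assms lower_boundary_subgradient by blast

text \<open>
  By refinement, the terms of an optimal \<open>\<rho>\<close>-decomposition lie in the components of one cell of \<open>\<phi>\<close>, so the
  decomposition is \<open>\<phi>\<close>-optimal as well; and a \<open>\<phi>\<close>-optimal decomposition of a point of the cell of direction \<open>v\<close>
  has its terms in the components of that cell.
\<close>
lemma optimal_decomposition_in_cell:
  assumes x: "(\<Sum>i\<le>n. y i) \<in> cell.Dom" and y: "\<And>i. i \<le> n \<Longrightarrow> y i \<in> \<Delta> i"
    and opt: "rho.Conv (\<Sum>i\<le>n. y i) = (\<Sum>i\<le>n. \<rho> i (y i))" and i: "i \<le> n"
  shows "y i \<in> D i"
proof -
  obtain t where t: "(\<Sum>i\<le>n. y i) \<in> Gam rho.Dom rho.Conv t"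
    using rho_subgradient x cell_Dom_subset by blast
  obtain t' where t': "\<And>i. i \<le> n \<Longrightarrow> Gam (\<Delta> i) (\<rho> i) t \<subseteq> Gam (\<Delta> i) (\<phi> i) t'"
    using refining_cell[of t] by metis
  have "\<forall>i\<le>n. y i \<in> Gam (\<Delta> i) (\<rho> i) t"
    using rho.Gam_sum_iff[of y t, OF y] t opt by blast
  then have "\<forall>i\<le>n. y i \<in> Gam (\<Delta> i) (\<phi> i) t'" using t' by blast
  then have "phi.Conv (\<Sum>i\<le>n. y i) = (\<Sum>i\<le>n. \<phi> i (y i))"
    using phi.Gam_sum_iff[of y t', OF y] by blast
  then show ?thesis
    using phi.Gam_sum_iff[of y v, OF y] x i unfolding cell_Dom by (simp add: cell_eq)
qed

lemma inf_conv_cell: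
  assumes x: "x \<in> cell.Dom"
  shows "cell.Conv x = rho.Conv x"
proof (rule antisym)
  obtain y where y: "\<And>i. i \<le> n \<Longrightarrow> y i \<in> \<Delta> i" "(\<Sum>i\<le>n. y i) = x"
    "rho.Conv x = (\<Sum>i\<le>n. \<rho> i (y i))"
    using rho.inf_conv_attained x cell_Dom_subset by blast
  have "y i \<in> D i" if "i \<le> n" for i
    using y x that by (intro optimal_decomposition_in_cell[of y]) auto
  with cell.inf_conv_le[of y] y show "cell.Conv x \<le> rho.Conv x" by simp
next
  obtain y where y: "\<And>i. i \<le> n \<Longrightarrow> y i \<in> D i" "(\<Sum>i\<le>n. y i) = x"
    "cell.Conv x = (\<Sum>i\<le>n. \<rho> i (y i))"
    using cell.inf_conv_attained[OF x] by blast
  have "y i \<in> \<Delta> i" if "i \<le> n" for i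
    using y(1)[OF that] by (simp add: cell_eq[OF that] Gam_def)
  with rho.inf_conv_le[of y] y show "rho.Conv x \<le> cell.Conv x" by simp
qed

lemma cell_Gam: "Gam cell.Dom cell.Conv t = Gam cell.Dom rho.Conv t"
  by (auto simp: Gam_def inf_conv_cell)

lemma convex_rho_Gam: "convex (Gam rho.Dom rho.Conv t)"
  using rho.inf_conv_lower_boundary convex_Gam by blast

lemma convex_cell_Gam: "convex (Gam cell.Dom cell.Conv t)"
  using cell.inf_conv_lower_boundary convex_Gam by blast

text \<open>
  The cell of \<open>\<phi>\<close> that contains the given cell of \<open>\<rho>\<close> also contains \<open>x\<close>, hence meets the cell of direction \<open>v\<close>
  in \<open>x\<close>.  The full-dimensional set \<open>T\<close>, which lies in one of these two cells of \<open>\<phi>\<close>, forces them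
  to coincide.
\<close>
lemma rho_cell_inside:
  assumes x: "x \<in> cell.Dom" "x \<in> Gam rho.Dom rho.Conv s"
    and T: "T \<subseteq> cell.Dom \<or> T \<subseteq> Gam rho.Dom rho.Conv s" "convex T" "aff_dim T = int n"
      "x \<in> rel_interior T"
  shows "Gam rho.Dom rho.Conv s \<subseteq> cell.Dom"
    and "i \<le> n \<Longrightarrow> Gam (\<Delta> i) (\<rho> i) s \<subseteq> D i"
proof -
  obtain s' where s': "Gam rho.Dom rho.Conv s \<subseteq> Gam phi.Dom phi.Conv s'"
    "\<And>i. i \<le> n \<Longrightarrow> Gam (\<Delta> i) (\<rho> i) s \<subseteq> Gam (\<Delta> i) (\<phi> i) s'"
    using refining_cell[of s] by metis
  have eq: "Gam phi.Dom phi.Conv s' = cell.Dom"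
    using T(1)
  proof
    assume "T \<subseteq> cell.Dom"
    then show ?thesis
      using Gam_eq_of_full_dim[OF L(1) Dom_subset, of T phi.Conv v x s'] T x s'(1) L(2)
      by (auto simp: cell_Dom)
  next
    assume "T \<subseteq> Gam rho.Dom rho.Conv s"
    then show ?thesis
      using Gam_eq_of_full_dim[OF L(1) Dom_subset, of T phi.Conv s' x v] T x s'(1) L(2)
      by (auto simp: cell_Dom)
  qed
  show "Gam rho.Dom rho.Conv s \<subseteq> cell.Dom" using s'(1) eq by simp
  show "Gam (\<Delta> i) (\<rho> i) s \<subseteq> D i" if i: "i \<le> n"
  proof -
    have "D i = component n \<Delta> \<phi> (Gam phi.Dom phi.Conv v) i"
      using i by (simp add: phi.component_Gam cell_eq)
    also have "\<dots> = component n \<Delta> \<phi> (Gam phi.Dom phi.Conv s') i"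
      by (simp add: eq cell_Dom)
    also have "\<dots> = Gam (\<Delta> i) (\<phi> i) s'" by (rule phi.component_Gam[OF i])
    finally show ?thesis using s'(2)[OF i] by simp
  qed
qed

text \<open>
  Every \<open>n\<close>-cell \<open>C\<close> of the subdivision of \<open>D\<close> is a cell of \<open>\<rho>\<close> with the same components: a cell of \<open>\<rho>\<close>
  through a relatively interior point of \<open>C\<close> lies inside \<open>cell.Dom\<close> and has the same direction as \<open>C\<close> on \<open>L\<close>.
\<close>
lemma tight_cell:
  assumes tight: "tight_mixed_subdivision n \<Delta> \<rho>"
  shows "tight_mixed_subdivision n D \<rho>"
  unfolding tight_mixed_subdivision_def
proof (intro ballI impI)
  fix C assume "C \<in> mixed_subdivision n D \<rho>" and dim: "aff_dim C = int n"
  then obtain t where C: "C = Gam cell.Dom cell.Conv t"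
    by (auto simp: mixed_subdivision_def subdivision_def)
  have conv: "convex C" by (simp add: C convex_cell_Gam)
  have "C \<noteq> {}" using dim by auto
  then obtain x where x: "x \<in> rel_interior C" using rel_interior_eq_empty[OF conv] by blast
  then have xC: "x \<in> C" using rel_interior_subset by blast
  have CD: "C \<subseteq> cell.Dom" by (auto simp: C Gam_def)
  obtain s where s: "x \<in> Gam rho.Dom rho.Conv s"
    using rho_subgradient xC CD cell_Dom_subset by blast
  have inside: "Gam rho.Dom rho.Conv s \<subseteq> cell.Dom" "\<And>i. i \<le> n \<Longrightarrow> Gam (\<Delta> i) (\<rho> i) s \<subseteq> D i"
    using rho_cell_inside[of x s C] xC CD s conv dim x by blast+
  have Es: "Gam cell.Dom cell.Conv s = Gam rho.Dom rho.Conv s"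
    unfolding cell_Gam using cell_Dom_subset inside(1) s by (intro Gam_restrict) blast+
  have "Gam cell.Dom cell.Conv s = C"
    unfolding C
  proof (rule Gam_eq_of_full_dim[OF L(1), of _ C])
    show "cell.Dom \<subseteq> L" using cell_Dom_subset Dom_subset by blast
  qed (use x s dim conv L(2) Es C in auto)
  then have CE: "C = Gam rho.Dom rho.Conv s" using Es by simp
  then have "C \<in> mixed_subdivision n \<Delta> \<rho>"
    by (simp add: mixed_subdivision_def subdivision_def)
  then have "(\<Sum>i\<le>n. aff_dim (component n \<Delta> \<rho> C i)) = int n"
    using tight dim unfolding tight_mixed_subdivision_def by blast
  moreover have "component n D \<rho> C i = component n \<Delta> \<rho> C i" if i: "i \<le> n" for i
  proof -
    have "Gam (\<Delta> i) (\<rho> i) s \<noteq> {}"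
      using rho.Gam_selection[of s] i by (metis empty_iff)
    moreover have "D i \<subseteq> \<Delta> i" using i by (auto simp: cell_eq Gam_def)
    ultimately have "Gam (D i) (\<rho> i) s = Gam (\<Delta> i) (\<rho> i) s"
      using inside(2)[OF i] by (intro Gam_restrict)
    then show ?thesis
      using rho.component_Gam[OF i, of s] cell.component_Gam[OF i, of s]
      by (simp add: Es flip: CE)
  qed
  ultimately show "(\<Sum>i\<le>n. aff_dim (component n D \<rho> C i)) = int n"
    by simp
qed

text \<open>
  Let \<open>x\<close> lie in a cell \<open>F\<close> of dimension below \<open>n\<close> of the subdivision of \<open>D\<close>, possibly on the boundary of
  \<open>D\<close>.  If a cell of \<open>\<rho>\<close> through \<open>x\<close> has dimension \<open>n\<close>, then \<open>x\<close> is not in its relative interior, since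
  otherwise that cell would equal \<open>F\<close>; and then \<open>x\<close> lies in a proper face, which is a cell of \<open>\<rho>\<close> of smaller dimension.
\<close>
lemma codim1_skeleton_cell: "codim1_skeleton n D \<rho> \<subseteq> codim1_skeleton n \<Delta> \<rho>"
proof
  fix x assume "x \<in> codim1_skeleton n D \<rho>"
  then obtain t where xF: "x \<in> Gam cell.Dom cell.Conv t"
    and dim: "aff_dim (Gam cell.Dom cell.Conv t) \<le> int n - 1"
    by (auto simp: codim1_skeleton_def mixed_subdivision_def subdivision_def)
  then have xD: "x \<in> cell.Dom" by (simp add: Gam_def)
  then obtain s where s: "x \<in> Gam rho.Dom rho.Conv s"
    using rho_subgradient cell_Dom_subset by blast
  let ?E = "Gam rho.Dom rho.Conv s"
  have EL: "?E \<subseteq> L" using Dom_subset by (auto simp: Gam_def)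
  have "\<exists>s'. x \<in> Gam rho.Dom rho.Conv s' \<and> aff_dim (Gam rho.Dom rho.Conv s') \<le> int n - 1"
  proof (cases "aff_dim ?E \<le> int n - 1")
    case True
    with s show ?thesis by blast
  next
    case False
    with aff_dim_subset[OF EL] L(2) have dimE: "aff_dim ?E = int n" by simp
    have "x \<notin> rel_interior ?E"
    proof
      assume ri: "x \<in> rel_interior ?E"
      have "?E \<subseteq> cell.Dom"
        using rho_cell_inside(1)[of x s ?E] xD s convex_rho_Gam dimE ri by blast
      then have Es: "Gam cell.Dom cell.Conv s = ?E"
        unfolding cell_Gam using cell_Dom_subset s by (intro Gam_restrict) blast+
      have "Gam cell.Dom cell.Conv t = Gam cell.Dom cell.Conv s"
      proof (rule Gam_eq_of_full_dim[OF L(1), of _ ?E])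
        show "cell.Dom \<subseteq> L" using cell_Dom_subset Dom_subset by blast
      qed (use ri xF dimE convex_rho_Gam L(2) Es in auto)
      with Es dimE dim show False by simp
    qed
    moreover obtain S where "lower_boundary S rho.Dom rho.Conv"
      using rho.inf_conv_lower_boundary by blast
    ultimately obtain s' where "x \<in> Gam rho.Dom rho.Conv s'"
      "aff_dim (Gam rho.Dom rho.Conv s') < aff_dim ?E"
      using Gam_proper_face[OF _ s] by blast
    with dimE show ?thesis by auto
  qed
  then show "x \<in> codim1_skeleton n \<Delta> \<rho>"
    by (auto simp: codim1_skeleton_def mixed_subdivision_def subdivision_def)
qed

end

theorem proposition4p8:
  fixes M :: "'a::euclidean_space set" and n :: nat
    and A \<Delta> D\<^sub>c :: "nat \<Rightarrow> 'a set"
    and \<rho> \<phi> :: "nat \<Rightarrow> 'a \<Rightarrow> real"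
    and \<delta> :: 'a and D :: "'a set"
  assumes "lattice_of_rank n M"
    and "\<And>i. i \<le> n \<Longrightarrow> finite (A i) \<and> A i \<noteq> {} \<and> A i \<subseteq> M"
    and "\<And>i. i \<le> n \<Longrightarrow> \<Delta> i = convex hull (A i)"
    and "\<And>i. i \<le> n \<Longrightarrow> cpa_defined_on (A i) (\<Delta> i) (\<rho> i)"
    and "tight_mixed_subdivision n \<Delta> \<rho>"
    and "\<delta> \<in> span M"
    and "generic_wrt M n \<Delta> \<rho> \<delta>"
    and "\<And>i. i \<le> n \<Longrightarrow> convex_piecewise_affine_on (\<Delta> i) (\<phi> i)"
    and "mixed_preceq n \<Delta> \<phi> \<rho>"
    and "D \<in> mixed_subdivision n \<Delta> \<phi>"
    and "aff_dim D = int n"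
    and "D\<^sub>c = component n \<Delta> \<phi> D"
  shows "(\<forall>i\<le>n. cpa_defined_on (A i \<inter> D\<^sub>c i) (D\<^sub>c i) (\<rho> i)) \<and>
    ((\<Sum>i\<le>n. D\<^sub>c i) = D \<and> (\<forall>x\<in>D. inf_conv n D\<^sub>c \<rho> x = inf_conv n \<Delta> \<rho> x)) \<and>
    tight_mixed_subdivision n D\<^sub>c \<rho> \<and>
    generic_wrt M n D\<^sub>c \<rho> \<delta>"
proof -
  have nonempty: "\<Delta> i \<noteq> {}" if "i \<le> n" for i using assms(2,3) that by simp
  interpret rho: polyhedral_family n \<Delta> \<rho>
  proof
    show "\<exists>S. lower_boundary S (\<Delta> i) (\<rho> i)" if "i \<le> n" for i
      using cpa_defined_onE[OF assms(4)[OF that]] by blast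
  qed (rule nonempty)
  interpret phi: polyhedral_family n \<Delta> \<phi>
  proof
    show "\<exists>S. lower_boundary S (\<Delta> i) (\<phi> i)" if "i \<le> n" for i
      using convex_piecewise_affine_onE[OF assms(8)[OF that]] by blast
  qed (rule nonempty)
  obtain v where D: "D = Gam phi.Dom phi.Conv v"
    using assms(10) by (auto simp: mixed_subdivision_def subdivision_def)
  have Dc: "D\<^sub>c i = Gam (\<Delta> i) (\<phi> i) v" if "i \<le> n" for i
    using phi.component_Gam[OF that] by (simp add: assms(12) D)
  interpret mixed_refinement n \<Delta> \<rho> \<phi>
    by unfold_locales (rule assms(9))
  have refine: "\<exists>t'. Gam (\<Delta> i) (\<rho> i) t \<subseteq> Gam (\<Delta> i) (\<phi> i) t'" if "i \<le> n" for i t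
    using refining_cell[of t] that by metis
  have cpa: "cpa_defined_on (A i \<inter> D\<^sub>c i) (D\<^sub>c i) (\<rho> i)" if i: "i \<le> n" for i
  proof -
    obtain T where "lower_boundary T (\<Delta> i) (\<phi> i)" using phi.lower_boundary_ex[OF i] by blast
    from cpa_defined_on_cell[OF assms(4)[OF i] this refine[OF i]] show ?thesis
      by (simp add: Dc[OF i])
  qed
  interpret cell: polyhedral_family n D\<^sub>c \<rho>
  proof
    show "\<exists>S. lower_boundary S (D\<^sub>c i) (\<rho> i)" if "i \<le> n" for i
      using cpa_defined_onE[OF cpa[OF that]] by blast
    show "D\<^sub>c i \<noteq> {}" if "i \<le> n" for i
      using Dc[OF that] phi.Gam_selection[of v] that by (metis empty_iff)
  qed
  obtain B where B: "independent B" "card B = n"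
    and M: "M = range (\<lambda>c. \<Sum>b\<in>B. real_of_int (c b) *\<^sub>R b)"
    using assms(1) unfolding lattice_of_rank_def by blast
  have "M \<subseteq> span B"
    by (auto simp: M intro!: span_sum span_scale intro: span_base)
  then have \<Delta>B: "\<Delta> i \<subseteq> span B" if "i \<le> n" for i
    unfolding assms(3)[OF that] using assms(2)[OF that]
    by (intro hull_minimal subspace_imp_convex subspace_span) auto
  interpret refined_cell n \<Delta> \<rho> \<phi> D\<^sub>c v "span B"
  proof
    show "D\<^sub>c i = Gam (\<Delta> i) (\<phi> i) v" if "i \<le> n" for i by (rule Dc[OF that])
    show "subspace (span B)" by simp
    show "aff_dim (span B) = int n"
      using B by (simp add: aff_dim_subspace dim_eq_card_independent)
    show "\<Delta> i \<subseteq> span B" if "i \<le> n" for i by (rule \<Delta>B[OF that])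
  qed
  have "generic_wrt M n D\<^sub>c \<rho> \<delta>"
    using assms(7) codim1_skeleton_cell unfolding generic_wrt_def by blast
  then show ?thesis
    using cpa cell_Dom inf_conv_cell tight_cell[OF assms(5)] D by simp
qed

end
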